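(* Consider the functional $$I(\mathbf{n})=\int_0^1|\mathbf{n}_x|^2\,dx$$ over $\mathcal{A}=\big\{\mathbf{n}\in W^{1,2}((0,1),\mathbb{S}^1):\mathbf{n}(0)=\mathbf{n}(1)=\mathbf{e}_1\big\}$. For each $k\in\mathbb{Z}$, the function $$\mathbf{n}_k(x)=\begin{pmatrix}\cos(2k\pi x)\\ \sin(2k\pi x)\end{pmatrix}$$ is a strict strong local minimizer of $I$.
   Context: $W^{1,2}((0,1),\mathbb{S}^1)=\{\mathbf{n}\in W^{1,2}((0,1),\mathbb{R}^2):|\mathbf{n}(x)|=1\text{ a.e.}\}$, $\mathbf{n}_x$ is the (weak) derivative, and $\mathbf{e}_1=(1,0)$. $\mathbf{n}\in\mathcal{A}$ is a strict strong local minimizer of $I$ if there is $\epsilon>0$ such that $I(\mathbf{m})>I(\mathbf{n})$ for all $\mathbf{m}\in\mathcal{A}$ with $0<\|\mathbf{n}-\mathbf{m}\|_\infty<\epsilon$. *)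

theory Defs
  imports "HOL-Analysis.Analysis" "HOL-Probability.Essential_Supremum"
begin

text \<open>
  Sobolev functions are represented by actual functions, which matter only up to equality almost
  everywhere on the open set \<open>\<Omega>\<close>.
\<close>

definition test_function :: "real set \<Rightarrow> (real \<Rightarrow> real) \<Rightarrow> bool" where
  "test_function \<Omega> \<phi> \<longleftrightarrow>
     (\<forall>k. (deriv ^^ k) \<phi> differentiable_on UNIV) \<and>
     compact (closure {x. \<phi> x \<noteq> 0}) \<and> closure {x. \<phi> x \<noteq> 0} \<subseteq> \<Omega>"

definition locally_integrable :: "real set \<Rightarrow> (real \<Rightarrow> 'a::euclidean_space) \<Rightarrow> bool" where
  "locally_integrable \<Omega> u \<longleftrightarrow> (\<forall>K. compact K \<and> K \<subseteq> \<Omega> \<longrightarrow> u absolutely_integrable_on K)"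

definition has_weak_derivative ::
    "real set \<Rightarrow> (real \<Rightarrow> 'a::euclidean_space) \<Rightarrow> (real \<Rightarrow> 'a) \<Rightarrow> bool" where
  "has_weak_derivative \<Omega> u g \<longleftrightarrow>
     locally_integrable \<Omega> u \<and> locally_integrable \<Omega> g \<and>
     (\<forall>\<phi>. test_function \<Omega> \<phi> \<longrightarrow>
        (LINT x|lebesgue_on \<Omega>. deriv \<phi> x *\<^sub>R u x) = - (LINT x|lebesgue_on \<Omega>. \<phi> x *\<^sub>R g x))"

text \<open>
  The weak derivative is determined only up to a null set, so an arbitrary representative is chosen;
  the integrals below do not depend on the choice.
\<close>

definition weak_deriv ::
    "real set \<Rightarrow> (real \<Rightarrow> 'a::euclidean_space) \<Rightarrow> (real \<Rightarrow> 'a)" where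
  "weak_deriv \<Omega> u = (SOME g. has_weak_derivative \<Omega> u g)"

definition L2 :: "real set \<Rightarrow> (real \<Rightarrow> 'a::euclidean_space) set" where
  "L2 \<Omega> = {u. u \<in> borel_measurable (lebesgue_on \<Omega>) \<and>
              integrable (lebesgue_on \<Omega>) (\<lambda>x. (norm (u x))\<^sup>2)}"

definition W12 :: "real set \<Rightarrow> (real \<Rightarrow> 'a::euclidean_space) set" where
  "W12 \<Omega> = {u \<in> L2 \<Omega>. \<exists>g \<in> L2 \<Omega>. has_weak_derivative \<Omega> u g}"

definition W12_sphere :: "real set \<Rightarrow> (real \<Rightarrow> real^2) set" where
  "W12_sphere \<Omega> = {n \<in> W12 \<Omega>. AE x in lebesgue_on \<Omega>. norm (n x) = 1}"

definition Linf_norm :: "real set \<Rightarrow> (real \<Rightarrow> 'a::euclidean_space) \<Rightarrow> ereal" where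
  "Linf_norm \<Omega> u = esssup (lebesgue_on \<Omega>) (\<lambda>x. ereal (norm (u x)))"

text \<open>
  Boundary values are those of the (unique) continuous representative on the closed interval; the
  values of \<open>u\<close> itself at the end points are irrelevant.
\<close>

definition has_boundary_values ::
    "(real \<Rightarrow> 'a::euclidean_space) \<Rightarrow> 'a \<Rightarrow> 'a \<Rightarrow> bool" where
  "has_boundary_values u a b \<longleftrightarrow>
     (\<exists>v. continuous_on {0..1} v \<and> (AE x in lebesgue_on {0<..<1}. u x = v x) \<and> v 0 = a \<and> v 1 = b)"

definition e1 :: "real^2" where
  "e1 = vector [1, 0]"

definition admissible :: "(real \<Rightarrow> real^2) set" where
  "admissible = {n \<in> W12_sphere {0<..<1}. has_boundary_values n e1 e1}"

definition energy :: "(real \<Rightarrow> real^2) \<Rightarrow> real" where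
  "energy n = (LINT x|lebesgue_on {0<..<1}. (norm (weak_deriv {0<..<1} n x))\<^sup>2)"

text \<open>
  The condition that the distance is positive says that \<open>m\<close> and \<open>n\<close> are different elements of the
  Sobolev space, i.e. not equal almost everywhere.
\<close>

definition strict_strong_local_minimizer ::
    "((real \<Rightarrow> real^2) \<Rightarrow> real) \<Rightarrow> (real \<Rightarrow> real^2) set \<Rightarrow> (real \<Rightarrow> real^2) \<Rightarrow> bool" where
  "strict_strong_local_minimizer I A n \<longleftrightarrow>
     n \<in> A \<and>
     (\<exists>\<epsilon>>0. \<forall>m\<in>A.
        0 < Linf_norm {0<..<1} (\<lambda>x. n x - m x) \<and>
        Linf_norm {0<..<1} (\<lambda>x. n x - m x) < ereal \<epsilon> \<longrightarrow> I m > I n)"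

definition n_k :: "int \<Rightarrow> real \<Rightarrow> real^2" where
  "n_k k x = vector [cos (2 * of_int k * pi * x), sin (2 * of_int k * pi * x)]"

end

theory Submission
  imports Defs
begin

text \<open>
  Write \<open>\<omega> = 2 k \<pi>\<close>. A competitor \<open>m\<close> that is uniformly close to \<open>n_k\<close> never points away from
  it, so its continuous representative has the form \<open>v = (cos \<theta>, sin \<theta>)\<close> with the continuous angle
  \<open>\<theta> x = \<omega> x + arcsin (b x)\<close>, where \<open>b\<close> is the component of \<open>v\<close> orthogonal to \<open>n_k\<close>. The boundary
  values give \<open>\<theta> 0 = 0\<close> and \<open>\<theta> 1 = \<omega>\<close>: closeness fixes the number of turns. Formally
  \<open>I m = \<integral> \<theta>'\<^sup>2\<close>, and among functions with these end values this is minimal, with value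
  \<open>\<omega>\<^sup>2\<close>, exactly for the linear one, that is for \<open>n_k\<close>.

  The proof avoids differentiating \<open>\<theta>\<close>, and so any chain rule for absolutely continuous functions.
  All that is needed is
  \<open>(\<theta> t - \<theta> s)\<^sup>2 \<le> (t - s) \<integral>\<^sub>s\<^sup>t |m_x|\<^sup>2\<close>.
  With chords \<open>|v t - v s|\<^sup>2 = 2 - 2 cos (\<theta> t - \<theta> s)\<close> in place of angles this is the
  Cauchy-Schwarz inequality (\<open>increment_energy_bound\<close>). For small increments chord and angle agree up
  to a factor close to 1, and the inequality for angles is inherited from small intervals by their
  union, so it holds for all intervals (\<open>angle_energy_bound\<close>). If \<open>m\<close> differs from \<open>n_k\<close>, then
  \<open>\<theta> x \<noteq> \<omega> x\<close> at some point \<open>x\<close>, and the inequality on \<open>[0, x]\<close> and on \<open>[x, 1]\<close> gives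
  \<open>I m \<ge> (\<theta> x)\<^sup>2 / x + (\<omega> - \<theta> x)\<^sup>2 / (1 - x) > \<omega>\<^sup>2\<close>.

  Two facts on weak derivatives enter. The increments of a continuous representative are the
  integrals of the weak derivative (\<open>has_weak_derivative_has_integral\<close>): test functions that
  approximate the indicator of an interval turn the definition into this formula. Hence the weak
  derivative is unique almost everywhere, which makes \<open>energy\<close> computable from any
  square-integrable weak derivative (\<open>energy_eq_integral\<close>). The test functions are built from a smooth step function, which in turn
  comes from the flat function \<open>exp (- 1 / x)\<close>.
\<close>

section \<open>Smooth step functions\<close>

definition flat :: "nat \<Rightarrow> real \<Rightarrow> real" where
  "flat n x = (if x > 0 then exp (- inverse x) * inverse x ^ n else 0)"

lemma flat_tendsto_0: "(flat n \<longlongrightarrow> 0) (at 0)"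
proof -
  have "((\<lambda>y::real. y ^ n / exp y) \<longlongrightarrow> 0) at_top"
    by (rule tendsto_power_div_exp_0)
  then have "((\<lambda>x::real. inverse x ^ n / exp (inverse x)) \<longlongrightarrow> 0) (at_right 0)"
    by (rule filterlim_compose[OF _ filterlim_inverse_at_top_right])
  then have r: "(flat n \<longlongrightarrow> 0) (at_right 0)"
    by (rule Lim_transform_eventually)
      (auto simp: flat_def eventually_at_filter exp_minus field_simps)
  have l: "(flat n \<longlongrightarrow> 0) (at_left 0)"
    by (rule tendsto_eventually) (auto simp: flat_def eventually_at_filter)
  show ?thesis
    using l r by (simp add: filterlim_at_split)
qed

text \<open>
  The derivative is again a combination of flat functions, so one formula covers derivatives of every
  order. At the origin the difference quotient of the flat function with exponent \<open>n\<close> is the flat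
  function with exponent \<open>n + 1\<close>.
\<close>

lemma DERIV_flat:
  "(flat n has_field_derivative (flat (n + 2) x - real n * flat (n + 1) x)) (at x)"
proof -
  consider "x > 0" | "x < 0" | "x = 0" by linarith
  then show ?thesis
  proof cases
    case 1
    have "((\<lambda>x. exp (- inverse x) * inverse x ^ n) has_field_derivative
        (flat (n + 2) x - real n * flat (n + 1) x)) (at x)"
      using 1 by (auto intro!: derivative_eq_intros simp: flat_def field_simps power2_eq_square)
        (cases n; simp add: field_simps)
    then show ?thesis
      by (rule has_field_derivative_transform_within_open[where S="{0<..}"])
        (use 1 in \<open>auto simp: flat_def\<close>)
  next
    case 2
    have "((\<lambda>x. 0) has_field_derivative (flat (n + 2) x - real n * flat (n + 1) x)) (at x)"
      using 2 by (auto simp: flat_def)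
    then show ?thesis
      by (rule has_field_derivative_transform_within_open[where S="{..<0}"])
        (use 2 in \<open>auto simp: flat_def\<close>)
  next
    case 3
    have "((\<lambda>h. (flat n (0 + h) - flat n 0) / h) \<longlongrightarrow> 0) (at 0)"
      by (rule Lim_transform_eventually[OF flat_tendsto_0[of "Suc n"]])
        (auto simp: flat_def eventually_at_filter field_simps)
    then show ?thesis
      using 3 by (simp add: DERIV_def flat_def)
  qed
qed

text \<open>
  Functions given by such a term are smooth because the class is closed under differentiation, which
  follows by induction from the usual rules. This avoids formulas for higher derivatives of products
  and reciprocals.
\<close>

inductive smooth_term :: "(real \<Rightarrow> real) \<Rightarrow> bool" where
  const: "smooth_term (\<lambda>x. c)"
| flat: "smooth_term (\<lambda>x. flat n (a * x + b))"
| add: "smooth_term f \<Longrightarrow> smooth_term g \<Longrightarrow> smooth_term (\<lambda>x. f x + g x)"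
| mult: "smooth_term f \<Longrightarrow> smooth_term g \<Longrightarrow> smooth_term (\<lambda>x. f x * g x)"
| inverse: "smooth_term f \<Longrightarrow> (\<And>x. f x \<noteq> 0) \<Longrightarrow> smooth_term (\<lambda>x. inverse (f x))"

lemma smooth_term_diff:
  assumes "smooth_term f" "smooth_term g"
  shows "smooth_term (\<lambda>x. f x - g x)"
  using smooth_term.add[OF assms(1) smooth_term.mult[OF smooth_term.const[of "-1"] assms(2)]]
  by simp

lemma smooth_term_affine:
  assumes "smooth_term f"
  shows "smooth_term (\<lambda>x. f (a * x + b))"
  using assms
proof induction
  case (flat n c d)
  have "(\<lambda>x. flat n (c * (a * x + b) + d)) = (\<lambda>x. flat n (c * a * x + (c * b + d)))"
    by (simp add: algebra_simps)
  then show ?case by (simp only: smooth_term.flat)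
qed (auto intro: smooth_term.intros)

lemma smooth_term_has_derivative:
  assumes "smooth_term f"
  obtains f' where "smooth_term f'" "\<And>x. (f has_field_derivative f' x) (at x)"
proof -
  have "\<exists>f'. smooth_term f' \<and> (\<forall>x. (f has_field_derivative f' x) (at x))"
    using assms
  proof induction
    case (const c)
    show ?case by (rule exI[of _ "\<lambda>x. 0"]) (auto intro: smooth_term.const)
  next
    case (flat n a b)
    let ?f' = "\<lambda>x. (flat (n + 2) (a * x + b) - real n * flat (n + 1) (a * x + b)) * a"
    have "smooth_term ?f'"
      by (intro smooth_term_diff smooth_term.intros)
    moreover have "((\<lambda>x. flat n (a * x + b)) has_field_derivative ?f' x) (at x)" for x
      by (rule DERIV_chain2[OF DERIV_flat]) (auto intro!: derivative_eq_intros)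
    ultimately show ?case by blast
  next
    case (add f g)
    then obtain f' g' where "smooth_term f'" "smooth_term g'"
      and "\<And>x. (f has_field_derivative f' x) (at x)" "\<And>x. (g has_field_derivative g' x) (at x)"
      by blast
    then show ?case
      by (intro exI[of _ "\<lambda>x. f' x + g' x"]) (auto intro: smooth_term.add DERIV_add)
  next
    case (mult f g)
    then obtain f' g' where "smooth_term f'" "smooth_term g'"
      and "\<And>x. (f has_field_derivative f' x) (at x)" "\<And>x. (g has_field_derivative g' x) (at x)"
      by blast
    with mult.hyps show ?case
      by (intro exI[of _ "\<lambda>x. f' x * g x + g' x * f x"])
        (auto intro: smooth_term.add smooth_term.mult DERIV_mult)
  next
    case (inverse f)
    then obtain f' where f': "smooth_term f'" "\<And>x. (f has_field_derivative f' x) (at x)"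
      by blast
    let ?g' = "\<lambda>x. (-1) * (inverse (f x) * f' x * inverse (f x))"
    have "smooth_term ?g'"
      by (intro smooth_term.mult smooth_term.const smooth_term.inverse inverse.hyps f')
    moreover have "((\<lambda>x. inverse (f x)) has_field_derivative ?g' x) (at x)" for x
      using DERIV_inverse'[OF f'(2)[of x] inverse.hyps(2)] by simp
    ultimately show ?case by blast
  qed
  then show ?thesis using that by blast
qed

lemma smooth_term_deriv: "smooth_term f \<Longrightarrow> smooth_term (deriv f)"
  and DERIV_smooth_term: "smooth_term f \<Longrightarrow> (f has_field_derivative deriv f x) (at x)"
proof -
  assume "smooth_term f"
  then obtain f' where f': "smooth_term f'" "\<And>x. (f has_field_derivative f' x) (at x)"
    by (rule smooth_term_has_derivative) blast
  then have "deriv f = f'"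
    by (auto intro!: DERIV_imp_deriv)
  with f' show "smooth_term (deriv f)" "(f has_field_derivative deriv f x) (at x)"
    by auto
qed

lemma smooth_term_higher_deriv_differentiable:
  assumes "smooth_term f"
  shows "(deriv ^^ k) f differentiable_on UNIV"
proof -
  have "smooth_term ((deriv ^^ k) f)"
    using assms by (induction k) (auto intro: smooth_term_deriv)
  then show ?thesis
    using DERIV_smooth_term[of "(deriv ^^ k) f"]
    by (intro differentiable_at_imp_differentiable_on) (auto simp: real_differentiable_def)
qed

lemma continuous_on_smooth_term: "smooth_term f \<Longrightarrow> continuous_on A f"
  by (meson DERIV_continuous_on DERIV_smooth_term has_field_derivative_at_within)

definition smooth_step :: "real \<Rightarrow> real" where
  "smooth_step t = flat 0 t * inverse (flat 0 t + flat 0 (1 - t))"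

text \<open>
  The two summands vanish on \<open>t \<le> 0\<close> and on \<open>t \<ge> 1\<close> respectively, hence never together.
\<close>

lemma smooth_step_denominator: "flat 0 t + flat 0 (1 - t) > 0"
  by (auto simp: flat_def add_pos_nonneg add_nonneg_pos)

lemma smooth_term_smooth_step: "smooth_term smooth_step"
proof -
  have "smooth_term (\<lambda>t. flat 0 (1 * t + 0) * inverse (flat 0 (1 * t + 0) + flat 0 ((-1) * t + 1)))"
    by (intro smooth_term.mult smooth_term.inverse smooth_term.add smooth_term.flat)
      (use smooth_step_denominator in \<open>force simp: less_le\<close>)
  then show ?thesis
    by (simp add: smooth_step_def[abs_def])
qed

lemma smooth_step_eq_0: "t \<le> 0 \<Longrightarrow> smooth_step t = 0"
  by (simp add: smooth_step_def flat_def)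

lemma smooth_step_eq_1: "t \<ge> 1 \<Longrightarrow> smooth_step t = 1"
  by (simp add: smooth_step_def flat_def)

lemma smooth_step_bounds: "0 \<le> smooth_step t" "smooth_step t \<le> 1"
  using smooth_step_denominator[of t]
  by (auto simp: smooth_step_def field_simps) (auto simp: flat_def)

lemma deriv_smooth_step_eq_0:
  assumes "t \<notin> {0..1}"
  shows "deriv smooth_step t = 0"
proof -
  have "(smooth_step has_field_derivative 0) (at t)"
  proof (cases "t < 0")
    case True
    show ?thesis
      by (rule has_field_derivative_transform_within_open[where f = "\<lambda>_. 0" and S = "{..<0}"])
        (use True in \<open>auto simp: smooth_step_eq_0\<close>)
  next
    case False
    with assms have "t > 1" by auto
    show ?thesis
      by (rule has_field_derivative_transform_within_open[where f = "\<lambda>_. 1" and S = "{1<..}"])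
        (use \<open>t > 1\<close> in \<open>auto simp: smooth_step_eq_1\<close>)
  qed
  then show ?thesis by (rule DERIV_imp_deriv)
qed

section \<open>An approximate identity\<close>

text \<open>
  The rescaled derivative of the smooth step has total mass 1 and is concentrated on \<open>[x, x + h]\<close>.
  These kernels form the approximate identity below.
\<close>

lemma has_integral_smooth_step_kernel:
  assumes "h > 0" "c \<le> x" "x + h \<le> d"
  shows "((\<lambda>t. deriv smooth_step ((t - x) / h) / h) has_integral 1) {c..d}"
proof -
  have "((\<lambda>t. smooth_step ((t - x) / h)) has_vector_derivative deriv smooth_step ((t - x) / h) / h)
      (at t within {c..d})" for t
    unfolding has_real_derivative_iff_has_vector_derivative[symmetric]
    by (rule DERIV_subset[OF DERIV_chain2[OF DERIV_smooth_term[OF smooth_term_smooth_step]], THEN DERIV_cong])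
      (use assms in \<open>auto intro!: derivative_eq_intros\<close>)
  then have "((\<lambda>t. deriv smooth_step ((t - x) / h) / h) has_integral
      (smooth_step ((d - x) / h) - smooth_step ((c - x) / h))) {c..d}"
    using assms by (intro fundamental_theorem_of_calculus) auto
  moreover have "(d - x) / h \<ge> 1" "(c - x) / h \<le> 0"
    using assms by (auto simp: field_simps)
  ultimately show ?thesis
    by (simp add: smooth_step_eq_0 smooth_step_eq_1)
qed

lemma smooth_step_kernel_continuous: "continuous_on A (\<lambda>t. deriv smooth_step ((t - x) / h) / h)"
proof -
  have "smooth_term (\<lambda>t. deriv smooth_step (inverse h * t + - x * inverse h) * inverse h)"
    by (intro smooth_term.mult smooth_term.const smooth_term_affine smooth_term_deriv
        smooth_term_smooth_step)
  then show ?thesis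
    by (auto dest!: continuous_on_smooth_term[of _ A] simp: field_simps diff_divide_distrib)
qed

text \<open>
  Since the kernel has mass 1, the error is the integral of the kernel against \<open>v t - v x\<close>. On the
  support of the kernel this increment is small, and the kernel is at most \<open>M / h\<close> on an interval of
  length \<open>h\<close>.
\<close>

lemma smooth_step_kernel_approximates:
  fixes v :: "real \<Rightarrow> 'a::euclidean_space"
  assumes v: "continuous_on {c..d} v" and x: "c \<le> x" "x < d"
    and h: "\<And>n. h n > 0" "\<And>n. x + h n \<le> d" "h \<longlonglongrightarrow> 0"
  shows "(\<lambda>n. integral {c..d} (\<lambda>t. (deriv smooth_step ((t - x) / h n) / h n) *\<^sub>R v t)) \<longlonglongrightarrow> v x"
proof (rule LIMSEQ_I)
  fix r :: real assume "r > 0"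
  have "continuous_on {0..1} (deriv smooth_step)"
    by (intro continuous_on_smooth_term smooth_term_deriv smooth_term_smooth_step)
  then have "bounded (deriv smooth_step ` {0..1})"
    by (intro compact_imp_bounded compact_continuous_image) auto
  then obtain M where M: "M > 0" "\<And>t. t \<in> {0..1} \<Longrightarrow> \<bar>deriv smooth_step t\<bar> \<le> M"
    by (auto simp: bounded_pos)
  have "x \<in> {c..d}" "r / (2 * M) > 0"
    using x \<open>r > 0\<close> M(1) by auto
  with v obtain \<delta> where \<delta>: "\<delta> > 0"
    "\<And>t. t \<in> {c..d} \<Longrightarrow> dist t x < \<delta> \<Longrightarrow> dist (v t) (v x) < r / (2 * M)"
    unfolding continuous_on_iff by blast
  obtain N where N: "\<And>n. n \<ge> N \<Longrightarrow> \<bar>h n\<bar> < \<delta>"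
    using LIMSEQ_D[OF h(3) \<delta>(1)] by auto
  show "\<exists>N. \<forall>n\<ge>N. norm (integral {c..d} (\<lambda>t. (deriv smooth_step ((t - x) / h n) / h n) *\<^sub>R v t) - v x) < r"
  proof (intro exI allI impI)
    fix n assume "n \<ge> N"
    let ?\<rho> = "\<lambda>t. deriv smooth_step ((t - x) / h n) / h n"
    note [continuous_intros] = smooth_step_kernel_continuous
    have hn: "h n > 0" "x + h n \<le> d" "h n < \<delta>"
      using h N[OF \<open>n \<ge> N\<close>] by auto
    have v': "continuous_on {x..x + h n} v"
      using v by (rule continuous_on_subset) (use x hn in auto)
    have 1: "((\<lambda>t. ?\<rho> t *\<^sub>R v x) has_integral v x) {c..d}"
      using has_integral_scaleR_left[OF has_integral_smooth_step_kernel[of "h n" c x d], of "v x"]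
        x hn by simp
    have 2: "((\<lambda>t. ?\<rho> t *\<^sub>R v t) has_integral integral {c..d} (\<lambda>t. ?\<rho> t *\<^sub>R v t)) {c..d}"
      by (intro integrable_integral integrable_continuous_real continuous_intros v)
    have 3: "((\<lambda>t. ?\<rho> t *\<^sub>R (v t - v x)) has_integral
        integral {x..x + h n} (\<lambda>t. ?\<rho> t *\<^sub>R (v t - v x))) {x..x + h n}" (is "(?f has_integral ?J) _")
      by (intro integrable_integral integrable_continuous_real continuous_intros v')
    then have "(?f has_integral ?J) {c..d}"
    proof (rule has_integral_on_superset)
      show "?f t = 0" if "t \<notin> {x..x + h n}" for t
        using that hn(1) by (subst deriv_smooth_step_eq_0) (auto simp: field_simps)
    qed (use x hn in auto)
    moreover have "(?f has_integral (integral {c..d} (\<lambda>t. ?\<rho> t *\<^sub>R v t) - v x)) {c..d}"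
      using has_integral_diff[OF 2 1] by (simp add: scaleR_diff_right)
    ultimately have "integral {c..d} (\<lambda>t. ?\<rho> t *\<^sub>R v t) - v x = ?J"
      by (rule has_integral_unique[symmetric])
    moreover have "norm ?J \<le> (M / h n * (r / (2 * M))) * measure lborel {x..x + h n}"
    proof (rule has_integral_bound_real[where S="{}", OF _ _ 3])
      show "norm (?f t) \<le> M / h n * (r / (2 * M))" if "t \<in> {x..x + h n} - {}" for t
      proof -
        have "\<bar>?\<rho> t\<bar> \<le> M / h n"
          using M(2)[of "(t - x) / h n"] that hn(1) by (auto simp: field_simps)
        moreover have "norm (v t - v x) \<le> r / (2 * M)"
          using \<delta>(2)[of t] that x hn by (auto simp: dist_norm)
        ultimately show ?thesis
          unfolding norm_scaleR using M(1) hn(1) by (intro mult_mono) auto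
      qed
    qed (use M(1) hn(1) \<open>r > 0\<close> in simp_all)
    moreover have "(M / h n * (r / (2 * M))) * measure lborel {x..x + h n} = r / 2"
      using M(1) hn(1) by simp
    ultimately have "norm (integral {c..d} (\<lambda>t. ?\<rho> t *\<^sub>R v t) - v x) \<le> r / 2"
      by (simp only:)
    then show "norm (integral {c..d} (\<lambda>t. ?\<rho> t *\<^sub>R v t) - v x) < r"
      by (rule le_less_trans) (use \<open>r > 0\<close> in simp)
  qed
qed

section \<open>Weak derivatives and increments\<close>

lemma AE_lebesgue_on_iff_negligible:
  assumes "S \<in> sets lebesgue"
  shows "(AE x in lebesgue_on S. P x) \<longleftrightarrow> (\<exists>N. negligible N \<and> (\<forall>x\<in>S - N. P x))"
proof -
  have "(AE x in lebesgue_on S. P x) \<longleftrightarrow> (AE x in lebesgue. x \<in> S \<longrightarrow> P x)"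
    using assms by (intro AE_restrict_space_iff) auto
  also have "\<dots> \<longleftrightarrow> (\<exists>N. negligible N \<and> (\<forall>x\<in>S - N. P x))"
    by (auto simp: eventually_ae_filter negligible_iff_null_sets subset_eq)
  finally show ?thesis .
qed

text \<open>
  The difference of two smooth steps of width \<open>h\<close>, starting at \<open>x\<close> and at \<open>y\<close>, is a test
  function. As \<open>h\<close> tends to 0 it converges to the indicator of \<open>(x, y]\<close>, while its derivative
  concentrates mass 1 at \<open>x\<close> and mass -1 at \<open>y\<close>; both sides of the definition of the weak derivative
  converge.
\<close>

lemma has_weak_derivative_has_integral:
  fixes u v g :: "real \<Rightarrow> 'a::euclidean_space"
  assumes wd: "has_weak_derivative {0<..<1} u g"
    and v: "continuous_on {0..1} v" "AE x in lebesgue_on {0<..<1}. u x = v x"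
    and xy: "0 < x" "x \<le> y" "y < 1"
  shows "(g has_integral (v y - v x)) {x..y}"
proof -
  \<comment> \<open>The widths are small enough that all test functions are supported in the compact interval
    \<open>[x, d]\<close>, on which \<open>g\<close> is integrable and so dominates the integrands.\<close>
  define h where "h n = (1 - y) / 2 * inverse (real (Suc n))" for n
  define d where "d = (1 + y) / 2"
  have d: "y < d" "d < 1" using xy by (auto simp: d_def)
  have h: "h n > 0" "y + h n \<le> d" "x + h n \<le> d" for n
  proof -
    show "h n > 0" using xy by (auto simp: h_def)
    have "h n \<le> (1 - y) / 2 * 1"
      unfolding h_def using xy by (intro mult_left_mono) (auto simp: field_simps)
    then show "y + h n \<le> d" "x + h n \<le> d"
      using xy by (auto simp: d_def field_simps)
  qed
  have h0: "h \<longlonglongrightarrow> 0"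
    unfolding h_def[abs_def] by (intro tendsto_mult_right_zero LIMSEQ_inverse_real_of_nat)
  let ?\<rho> = "\<lambda>x n t. deriv smooth_step ((t - x) / h n) / h n"
  define \<phi> where "\<phi> n t = smooth_step ((t - x) / h n) - smooth_step ((t - y) / h n)" for n t
  have smooth: "smooth_term (\<phi> n)" for n
  proof -
    have "smooth_term (\<lambda>t. smooth_step (inverse (h n) * t + - x * inverse (h n)) -
        smooth_step (inverse (h n) * t + - y * inverse (h n)))"
      by (intro smooth_term_diff smooth_term_affine smooth_term_smooth_step)
    then show ?thesis
      by (simp add: \<phi>_def[abs_def] field_simps diff_divide_distrib)
  qed
  have supp: "\<phi> n t = 0" if "t \<notin> {x..d}" for n t
  proof -
    have "t \<le> x \<or> t \<ge> y + h n" using that h(2)[of n] xy by auto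
    then show ?thesis
      using xy h(1)[of n] unfolding \<phi>_def
      by (auto simp: smooth_step_eq_0 smooth_step_eq_1 field_simps divide_nonpos_pos)
  qed
  have test: "test_function {0<..<1} (\<phi> n)" for n
  proof -
    have "closure {t. \<phi> n t \<noteq> 0} \<subseteq> {x..d}"
      using supp[of _ n] by (intro closure_minimal subsetI) (blast, simp)
    moreover from this have "compact (closure {t. \<phi> n t \<noteq> 0})"
      unfolding compact_eq_bounded_closed using bounded_subset[OF bounded_closed_interval] by blast
    moreover have "{x..d} \<subseteq> {0<..<1}"
      using xy d by auto
    ultimately show ?thesis
      using smooth_term_higher_deriv_differentiable[OF smooth]
      unfolding test_function_def by blast
  qed
  have deriv_\<phi>: "deriv (\<phi> n) t = ?\<rho> x n t - ?\<rho> y n t" for n t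
  proof (rule DERIV_imp_deriv)
    note D = DERIV_chain2[OF DERIV_smooth_term[OF smooth_term_smooth_step]]
    show "(\<phi> n has_field_derivative ?\<rho> x n t - ?\<rho> y n t) (at t)"
      unfolding \<phi>_def[abs_def] using h(1)[of n]
      by (auto intro!: derivative_eq_intros D)
  qed
  let ?A = "\<lambda>n. LINT t|lebesgue_on {0<..<1}. deriv (\<phi> n) t *\<^sub>R u t"
  have A: "?A n = integral {0..1} (\<lambda>t. ?\<rho> x n t *\<^sub>R v t) - integral {0..1} (\<lambda>t. ?\<rho> y n t *\<^sub>R v t)" for n
  proof -
    note [continuous_intros] = smooth_step_kernel_continuous
    have "continuous_on {0..1} (\<lambda>t. deriv (\<phi> n) t *\<^sub>R v t)"
      unfolding deriv_\<phi> by (intro continuous_intros v)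
    then have av: "(\<lambda>t. deriv (\<phi> n) t *\<^sub>R v t) absolutely_integrable_on {0<..<1}"
      unfolding absolutely_integrable_on_Icc_iff_Ioo[symmetric]
      by (rule absolutely_integrable_continuous_real)
    obtain N where N: "negligible N" "\<And>t. t \<in> {0<..<1} - N \<Longrightarrow> u t = v t"
      using v(2) by (subst (asm) AE_lebesgue_on_iff_negligible) auto
    have "(\<lambda>t. deriv (\<phi> n) t *\<^sub>R u t) absolutely_integrable_on {0<..<1}"
      by (rule absolutely_integrable_spike[OF av N(1)]) (simp add: N(2))
    then have "?A n = integral {0<..<1} (\<lambda>t. deriv (\<phi> n) t *\<^sub>R u t)"
      by (intro lebesgue_integral_eq_integral) (simp_all add: integrable_restrict_space set_integrable_def)
    also have "\<dots> = integral {0<..<1} (\<lambda>t. deriv (\<phi> n) t *\<^sub>R v t)"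
      by (rule integral_spike[OF N(1)]) (simp add: N(2))
    also have "\<dots> = integral {0..1} (\<lambda>t. deriv (\<phi> n) t *\<^sub>R v t)"
      by (simp add: integral_open_interval_real)
    also have "\<dots> = integral {0..1} (\<lambda>t. ?\<rho> x n t *\<^sub>R v t - ?\<rho> y n t *\<^sub>R v t)"
      by (simp add: deriv_\<phi> scaleR_diff_left)
    also have "\<dots> = integral {0..1} (\<lambda>t. ?\<rho> x n t *\<^sub>R v t) - integral {0..1} (\<lambda>t. ?\<rho> y n t *\<^sub>R v t)"
      by (intro Henstock_Kurzweil_Integration.integral_diff integrable_continuous_real continuous_intros v)
    finally show ?thesis .
  qed
  have hd: "x + h n \<le> 1" "y + h n \<le> 1" for n
    using h(2,3)[of n] d by auto
  have lim: "?A \<longlonglongrightarrow> v x - v y"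
    unfolding A using xy h(1) hd h0 v(1)
    by (intro tendsto_diff smooth_step_kernel_approximates) auto
  have g: "g absolutely_integrable_on {x..d}"
  proof -
    have "compact {x..d}" "{x..d} \<subseteq> {0<..<1}"
      using xy d by auto
    with wd show ?thesis
      unfolding has_weak_derivative_def locally_integrable_def by blast
  qed
  have B: "((\<lambda>t. \<phi> n t *\<^sub>R g t) has_integral - ?A n) {x..d}" for n
  proof -
    have ai: "(\<lambda>t. \<phi> n t *\<^sub>R g t) absolutely_integrable_on {x..d}"
    proof (rule absolutely_integrable_bounded_measurable_product[where h="\<lambda>r z. r *\<^sub>R z", OF _ _ _ _ g])
      have c: "continuous_on {x..d} (\<phi> n)"
        by (rule continuous_on_smooth_term[OF smooth])
      then show "\<phi> n \<in> borel_measurable (lebesgue_on {x..d})"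
        by (rule continuous_imp_measurable_on_sets_lebesgue) auto
      show "bounded (\<phi> n ` {x..d})"
        using c by (intro compact_imp_bounded compact_continuous_image) auto
      show "bilinear ((*\<^sub>R) :: real \<Rightarrow> 'a \<Rightarrow> 'a)"
        by (simp add: bilinear_conv_bounded_bilinear bounded_bilinear_scaleR)
    qed auto
    have e1: "{t \<in> {0<..<1} - {x..d}. \<phi> n t *\<^sub>R g t \<noteq> 0} = {}"
      using supp[of _ n] by auto
    have e2: "{t \<in> {x..d} - {0<..<1}. \<phi> n t *\<^sub>R g t \<noteq> 0} = {}"
      using xy d by auto
    have "(\<lambda>t. \<phi> n t *\<^sub>R g t) absolutely_integrable_on {x..d} \<longleftrightarrow>
        (\<lambda>t. \<phi> n t *\<^sub>R g t) absolutely_integrable_on {0<..<1}"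
      by (rule absolutely_integrable_spike_set_eq) (simp_all only: e1 e2 negligible_empty)
    with ai have "(\<lambda>t. \<phi> n t *\<^sub>R g t) absolutely_integrable_on {0<..<1}"
      by blast
    then have "((\<lambda>t. \<phi> n t *\<^sub>R g t) has_integral (LINT t|lebesgue_on {0<..<1}. \<phi> n t *\<^sub>R g t)) {0<..<1}"
      by (intro has_integral_integral_lebesgue_on) (simp_all add: integrable_restrict_space set_integrable_def)
    moreover have "(LINT t|lebesgue_on {0<..<1}. \<phi> n t *\<^sub>R g t) = - ?A n"
      using wd test[of n] unfolding has_weak_derivative_def by simp
    ultimately have "((\<lambda>t. \<phi> n t *\<^sub>R g t) has_integral - ?A n) {0<..<1}"
      by simp
    then show ?thesis
      by (rule iffD1[OF has_integral_spike_set_eq, rotated 2]) (simp_all only: e1 e2 negligible_empty)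
  qed
  have "((\<lambda>t. if t \<in> {x<..y} then g t else 0) has_integral - (v x - v y)) {x..d}"
  proof (rule has_integral_dominated_convergence[OF B])
    show "(\<lambda>t. norm (g t)) integrable_on {x..d}"
      using g by (simp add: absolutely_integrable_on_def)
    show "\<forall>t\<in>{x..d}. norm (\<phi> n t *\<^sub>R g t) \<le> norm (g t)" for n
    proof
      fix t
      have "\<bar>\<phi> n t\<bar> \<le> 1"
        using smooth_step_bounds[of "(t - x) / h n"] smooth_step_bounds[of "(t - y) / h n"]
        unfolding \<phi>_def by linarith
      then show "norm (\<phi> n t *\<^sub>R g t) \<le> norm (g t)"
        using mult_right_mono[of "\<bar>\<phi> n t\<bar>" 1 "norm (g t)"] by simp
    qed
    show "\<forall>t\<in>{x..d}. (\<lambda>n. \<phi> n t *\<^sub>R g t) \<longlonglongrightarrow> (if t \<in> {x<..y} then g t else 0)"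
    proof
      fix t
      have lim_step: "(\<lambda>n. smooth_step ((t - a) / h n)) \<longlonglongrightarrow> (if t \<le> a then 0 else 1)" for a
      proof (cases "t \<le> a")
        case True
        then show ?thesis
          using h(1) by (simp add: smooth_step_eq_0 divide_nonpos_pos)
      next
        case False
        then have "\<forall>\<^sub>F n in sequentially. h n < t - a"
          using h0 by (intro order_tendstoD) auto
        then have "\<forall>\<^sub>F n in sequentially. smooth_step ((t - a) / h n) = 1"
          by eventually_elim (use h(1) in \<open>simp add: smooth_step_eq_1\<close>)
        then show ?thesis
          using False by (simp add: tendsto_eventually)
      qed
      have "(\<lambda>n. \<phi> n t *\<^sub>R g t) \<longlonglongrightarrow> ((if t \<le> x then 0 else 1) - (if t \<le> y then 0 else 1)) *\<^sub>R g t"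
        unfolding \<phi>_def by (intro tendsto_intros lim_step)
      then show "(\<lambda>n. \<phi> n t *\<^sub>R g t) \<longlonglongrightarrow> (if t \<in> {x<..y} then g t else 0)"
        using xy by (auto split: if_splits)
    qed
    show "(\<lambda>n. - ?A n) \<longlonglongrightarrow> - (v x - v y)"
      by (intro tendsto_minus lim)
  qed
  then have "((\<lambda>t. if t \<in> {x<..y} then g t else 0) has_integral (v y - v x)) {x..d}"
    by simp
  then have "(g has_integral (v y - v x)) {x<..y}"
    by (subst (asm) has_integral_restrict) (use xy d in auto)
  then show ?thesis
    by (rule iffD1[OF has_integral_spike_set_eq, rotated 2]) (auto intro: negligible_subset[of "{x}"])
qed

text \<open>
  By Lebesgue's differentiation theorem an integrable function is almost everywhere the limit of its
  averages over small intervals. That theorem asks for integrability on all intervals, so \<open>f\<close> is cut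
  off to compact intervals that exhaust \<open>(0, 1)\<close>.
\<close>

lemma AE_zero_if_interval_integrals_zero:
  fixes f :: "real \<Rightarrow> 'a::euclidean_space"
  assumes zero: "\<And>x y. 0 < x \<Longrightarrow> x \<le> y \<Longrightarrow> y < 1 \<Longrightarrow> (f has_integral 0) {x..y}"
  shows "AE x in lebesgue_on {0<..<1}. f x = 0"
proof -
  define K where "K n = {inverse (real n + 2)..1 - inverse (real n + 2)}" for n :: nat
  define F where "F n x = (if x \<in> K n then f x else 0)" for n x
  have F0: "(F n has_integral 0) {a..b}" for n a b
  proof -
    let ?l = "max (inverse (real n + 2)) a" and ?r = "min (1 - inverse (real n + 2)) b"
    have "0 < inverse (real n + 2)"
      by simp
    then have "0 < ?l" "?r < 1"
      by linarith+
    then have "(f has_integral 0) {?l..?r}"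
      by (cases "?l \<le> ?r") (auto intro: zero)
    then show ?thesis
      unfolding F_def has_integral_restrict_Int by (simp add: K_def max.commute min.commute)
  qed
  have "\<exists>N. negligible N \<and> (\<forall>x. x \<notin> N \<longrightarrow> F n x = 0)" for n
  proof -
    have "F n integrable_on cbox a b" for a b
      using F0[of n a b] by auto
    then obtain N where N: "negligible N"
      "\<And>x e. x \<notin> N \<Longrightarrow> 0 < e \<Longrightarrow> \<exists>d>0. \<forall>h. 0 < h \<and> h < d \<longrightarrow>
        norm (integral (cbox x (x + h *\<^sub>R One)) (F n) /\<^sub>R h ^ DIM(real) - F n x) < e"
      by (rule integrable_ccontinuous_explicit) blast
    have "F n x = 0" if x: "x \<notin> N" for x
    proof (rule ccontr)
      assume "F n x \<noteq> 0"
      then obtain d where d: "d > 0" "\<And>h. 0 < h \<Longrightarrow> h < d \<Longrightarrow>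
          norm (integral (cbox x (x + h *\<^sub>R One)) (F n) /\<^sub>R h ^ DIM(real) - F n x) < norm (F n x)"
        using N(2)[OF x, of "norm (F n x)"] by auto
      from d(2)[of "d / 2"] d(1) integral_unique[OF F0[of n x "x + d / 2"]] show False
        by simp
    qed
    with N(1) show ?thesis by blast
  qed
  then obtain N where N: "\<And>n. negligible (N n)" "\<And>n x. x \<notin> N n \<Longrightarrow> F n x = 0"
    by metis
  have "f x = 0" if x: "x \<in> {0<..<1} - (\<Union>n. N n)" for x
  proof -
    have "0 < min x (1 - x)"
      using x by auto
    then obtain n where "inverse (real (Suc n)) < min x (1 - x)"
      using reals_Archimedean by blast
    moreover have "inverse (real n + 2) \<le> inverse (real (Suc n))"
      by (intro le_imp_inverse_le) auto
    ultimately have "x \<in> K n"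
      unfolding K_def atLeastAtMost_iff min_less_iff_conj by linarith
    with N(2)[of x n] x show ?thesis
      by (auto simp: F_def)
  qed
  then show ?thesis
    using negligible_Union_nat[of N] N(1)
    by (subst AE_lebesgue_on_iff_negligible) (simp, blast)
qed

lemma has_weak_derivative_unique:
  fixes u v g g' :: "real \<Rightarrow> 'a::euclidean_space"
  assumes "has_weak_derivative {0<..<1} u g" "has_weak_derivative {0<..<1} u g'"
    and "continuous_on {0..1} v" "AE x in lebesgue_on {0<..<1}. u x = v x"
  shows "AE x in lebesgue_on {0<..<1}. g x = g' x"
proof -
  have "((\<lambda>t. g t - g' t) has_integral 0) {x..y}" if "0 < x" "x \<le> y" "y < 1" for x y
    using has_integral_diff[OF has_weak_derivative_has_integral[OF assms(1,3,4) that]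
        has_weak_derivative_has_integral[OF assms(2,3,4) that]] by simp
  from AE_zero_if_interval_integrals_zero[OF this] show ?thesis
    by simp
qed

lemma square_integrable_on_if_L2:
  fixes g :: "real \<Rightarrow> 'a::euclidean_space"
  assumes "g \<in> L2 {a<..<b}"
  shows "(\<lambda>x. (norm (g x))\<^sup>2) absolutely_integrable_on {a..b}"
  using assms unfolding absolutely_integrable_on_Icc_iff_Ioo L2_def
  by (simp add: integrable_restrict_space set_integrable_def)

text \<open>
  The energy is defined through an arbitrarily chosen weak derivative. Uniqueness allows any
  square-integrable one to be used instead.
\<close>

lemma energy_eq_integral:
  fixes u v g :: "real \<Rightarrow> real^2"
  assumes wd: "has_weak_derivative {0<..<1} u g" and g: "g \<in> L2 {0<..<1}"
    and v: "continuous_on {0..1} v" "AE x in lebesgue_on {0<..<1}. u x = v x"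
  shows "energy u = integral {0..1} (\<lambda>x. (norm (g x))\<^sup>2)"
proof -
  let ?d = "weak_deriv {0<..<1} u"
  have "has_weak_derivative {0<..<1} u ?d"
    unfolding weak_deriv_def using wd by (rule someI[of "has_weak_derivative {0<..<1} u"])
  from has_weak_derivative_unique[OF this wd v]
  obtain N where N: "negligible N" "\<And>x. x \<in> {0<..<1} - N \<Longrightarrow> ?d x = g x"
    by (subst (asm) AE_lebesgue_on_iff_negligible) auto
  have "(\<lambda>x. (norm (g x))\<^sup>2) absolutely_integrable_on {0<..<1}"
    using square_integrable_on_if_L2[OF g] unfolding absolutely_integrable_on_Icc_iff_Ioo .
  then have "(\<lambda>x. (norm (?d x))\<^sup>2) absolutely_integrable_on {0<..<1}"
    by (rule absolutely_integrable_spike[OF _ N(1)]) (simp add: N(2))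
  then have "energy u = integral {0<..<1} (\<lambda>x. (norm (?d x))\<^sup>2)"
    unfolding energy_def
    by (intro lebesgue_integral_eq_integral) (simp_all add: integrable_restrict_space set_integrable_def)
  also have "\<dots> = integral {0<..<1} (\<lambda>x. (norm (g x))\<^sup>2)"
    by (rule integral_spike[OF N(1)]) (simp add: N(2))
  finally show ?thesis
    by (simp add: integral_open_interval_real)
qed

text \<open>
  Integration by parts; a test function vanishes at 0 and 1 because its support lies in the open
  interval.
\<close>

lemma C1_has_weak_derivative:
  fixes v v' :: "real \<Rightarrow> 'a::euclidean_space"
  assumes v: "\<And>t. (v has_vector_derivative v' t) (at t)" and v': "continuous_on UNIV v'"
  shows "has_weak_derivative {0<..<1} v v'"
proof -
  have cv: "continuous_on A v" for A
    using v by (meson continuous_on_vector_derivative has_vector_derivative_at_within)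
  have cv': "continuous_on A v'" for A
    using v' by (rule continuous_on_subset) simp
  have li: "locally_integrable {0<..<1} f" if "\<And>A. continuous_on A f" for f :: "real \<Rightarrow> 'a"
    unfolding locally_integrable_def
  proof (intro allI impI)
    fix K :: "real set" assume K: "compact K \<and> K \<subseteq> {0<..<1}"
    have "f absolutely_integrable_on {0..1}"
      by (rule absolutely_integrable_continuous_real[OF that])
    then show "f absolutely_integrable_on K"
      by (rule set_integrable_subset) (use K in \<open>auto simp: borel_compact\<close>)
  qed
  have "(LINT t|lebesgue_on {0<..<1}. deriv \<phi> t *\<^sub>R v t) = - (LINT t|lebesgue_on {0<..<1}. \<phi> t *\<^sub>R v' t)"
    if \<phi>: "test_function {0<..<1} \<phi>" for \<phi>
  proof -
    have d: "(deriv ^^ k) \<phi> differentiable_on UNIV" for k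
      using \<phi> by (simp add: test_function_def)
    have c: "continuous_on A \<phi>" "continuous_on A (deriv \<phi>)" for A
      using d[of 0] d[of 1]
      by (auto dest!: differentiable_imp_continuous_on intro: continuous_on_subset)
    have D: "(\<phi> has_field_derivative deriv \<phi> t) (at t)" for t
      using d[of 0] by (simp add: differentiable_on_def DERIV_deriv_iff_real_differentiable)
    have "{t. \<phi> t \<noteq> 0} \<subseteq> {0<..<1}"
      using \<phi> closure_subset[of "{t. \<phi> t \<noteq> 0}"] by (auto simp: test_function_def)
    then have b: "\<phi> 0 = 0" "\<phi> 1 = 0"
      by force+
    have LINT: "(LINT t|lebesgue_on {0<..<1}. f t) = integral {0..1} f"
      if "continuous_on {0..1} f" for f :: "real \<Rightarrow> 'a"
    proof -
      have "f absolutely_integrable_on {0<..<1}"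
        using absolutely_integrable_continuous_real[OF that]
        unfolding absolutely_integrable_on_Icc_iff_Ioo .
      then show ?thesis
        unfolding integral_open_interval_real
        by (intro lebesgue_integral_eq_integral)
          (simp_all add: integrable_restrict_space set_integrable_def)
    qed
    have "((\<lambda>t. \<phi> t *\<^sub>R v' t + deriv \<phi> t *\<^sub>R v t) has_integral (\<phi> 1 *\<^sub>R v 1 - \<phi> 0 *\<^sub>R v 0)) {0..1}"
      by (intro fundamental_theorem_of_calculus has_vector_derivative_scaleR
          has_field_derivative_at_within[OF D] has_vector_derivative_at_within[OF v]) simp
    then have "integral {0..1} (\<lambda>t. \<phi> t *\<^sub>R v' t + deriv \<phi> t *\<^sub>R v t) = 0"
      by (simp add: b integral_unique)
    then have "integral {0..1} (\<lambda>t. \<phi> t *\<^sub>R v' t) + integral {0..1} (\<lambda>t. deriv \<phi> t *\<^sub>R v t) = 0"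
      by (subst (asm) Henstock_Kurzweil_Integration.integral_add)
        (intro integrable_continuous_real continuous_on_scaleR c cv cv' | assumption)+
    then show ?thesis
      by (subst (1 2) LINT) (auto intro!: continuous_on_scaleR c cv cv' simp: add_eq_0_iff)
  qed
  with li[OF cv] li[OF cv'] show ?thesis
    unfolding has_weak_derivative_def by blast
qed

section \<open>Energy bounds for chords and angles\<close>

text \<open>
  The integral of \<open>|g - c|\<^sup>2\<close> is nonnegative; \<open>c\<close> is the mean value of \<open>g\<close>.
\<close>

lemma Cauchy_Schwarz_has_integral:
  fixes g :: "real \<Rightarrow> 'a::euclidean_space"
  assumes g: "(g has_integral I) {s..t}" and g2: "(\<lambda>x. (norm (g x))\<^sup>2) integrable_on {s..t}"
    and "s \<le> t"
  shows "(norm I)\<^sup>2 \<le> (t - s) * integral {s..t} (\<lambda>x. (norm (g x))\<^sup>2)"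
proof (cases "s = t")
  case True
  with g have "I = 0"
    by (metis has_integral_refl(2) has_integral_unique atLeastAtMost_singleton)
  with True show ?thesis by simp
next
  case False
  with \<open>s \<le> t\<close> have st: "t - s > 0" by simp
  let ?E = "integral {s..t} (\<lambda>x. (norm (g x))\<^sup>2)"
  define c where "c = I /\<^sub>R (t - s)"
  have "((\<lambda>x. (norm (g x))\<^sup>2 - 2 * (g x \<bullet> c) + (norm c)\<^sup>2) has_integral
      (?E - 2 * (I \<bullet> c) + (t - s) * (norm c)\<^sup>2)) {s..t}"
    using g2 \<open>s \<le> t\<close> has_integral_const_real[of "(norm c)\<^sup>2" s t]
      has_integral_linear[OF g bounded_linear_inner_left[of c]]
    by (intro has_integral_add has_integral_diff has_integral_mult_right)
      (auto simp: integrable_integral o_def)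
  moreover have "(norm (g x))\<^sup>2 - 2 * (g x \<bullet> c) + (norm c)\<^sup>2 = (norm (g x - c))\<^sup>2" for x
    by (simp add: power2_norm_eq_inner inner_diff_left inner_diff_right inner_commute)
  ultimately have "((\<lambda>x. (norm (g x - c))\<^sup>2) has_integral
      (?E - 2 * (I \<bullet> c) + (t - s) * (norm c)\<^sup>2)) {s..t}"
    by simp
  then have "0 \<le> ?E - 2 * (I \<bullet> c) + (t - s) * (norm c)\<^sup>2"
    by (rule has_integral_nonneg) simp
  also have "I \<bullet> c = (norm I)\<^sup>2 / (t - s)"
    by (simp add: c_def power2_norm_eq_inner divide_inverse mult.commute)
  also have "(t - s) * (norm c)\<^sup>2 = (norm I)\<^sup>2 / (t - s)"
    using st by (simp add: c_def power2_eq_square inverse_eq_divide)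
  finally have "(norm I)\<^sup>2 / (t - s) \<le> ?E"
    by simp
  then show ?thesis
    using st by (simp add: pos_divide_le_eq mult.commute)
qed

text \<open>
  The left-hand side of the bound is a multiple of the square of an angle, the right-hand side is the
  squared chord \<open>4 sin\<^sup>2 (u / 2)\<close>. Their ratio tends to 1 at 0.
\<close>

lemma cos_quadratic_bound:
  fixes c :: real
  assumes "c < 1"
  obtains \<delta> where "\<delta> > 0" "\<And>u. \<bar>u\<bar> < \<delta> \<Longrightarrow> c * u\<^sup>2 \<le> 2 - 2 * cos u"
proof -
  have "((\<lambda>x::real. sin x / x) \<longlongrightarrow> 1) (at 0)"
    using DERIV_sin[of "0::real"] by (simp add: DERIV_def)
  then have "((\<lambda>x::real. (sin x / x)\<^sup>2) \<longlongrightarrow> 1\<^sup>2) (at 0)"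
    by (rule tendsto_power)
  then have "\<forall>\<^sub>F x::real in at 0. c < (sin x / x)\<^sup>2"
    using assms by (intro order_tendstoD) auto
  then obtain d where d: "d > 0" "\<And>x::real. x \<noteq> 0 \<Longrightarrow> \<bar>x\<bar> < d \<Longrightarrow> c < (sin x / x)\<^sup>2"
    by (auto simp: eventually_at)
  show ?thesis
  proof
    show "2 * d > 0" using d by simp
    fix u :: real assume u: "\<bar>u\<bar> < 2 * d"
    have "2 - 2 * cos u = 4 * (sin (u / 2))\<^sup>2"
      using cos_double_sin[of "u / 2"] by simp
    moreover have "c * (u / 2)\<^sup>2 \<le> (sin (u / 2))\<^sup>2"
      using d(2)[of "u / 2"] u by (cases "u = 0") (auto simp: field_simps)
    ultimately show "c * u\<^sup>2 \<le> 2 - 2 * cos u"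
      by (simp add: power_divide)
  qed
qed

text \<open>
  This is the convexity that makes the angle inequality additive: a bound
  \<open>(\<theta> t - \<theta> s)\<^sup>2 \<le> (t - s) \<integral>\<^sub>s\<^sup>t F\<close> on two adjacent intervals, with increments
  \<open>A, B\<close>, lengths \<open>a, b\<close> and energies \<open>P, Q\<close>, passes to their union.
\<close>

lemma quadratic_bounds_combine:
  fixes A B P Q a b c :: real
  assumes "c \<ge> 0" "a \<ge> 0" "b \<ge> 0" "P \<ge> 0" "Q \<ge> 0"
    and A: "c * A\<^sup>2 \<le> a * P" and B: "c * B\<^sup>2 \<le> b * Q"
  shows "c * (A + B)\<^sup>2 \<le> (a + b) * (P + Q)"
proof -
  have "(2 * (c * (A * B)))\<^sup>2 = 4 * ((c * A\<^sup>2) * (c * B\<^sup>2))"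
    by (simp add: power2_eq_square)
  also have "\<dots> \<le> 4 * ((a * P) * (b * Q))"
    using mult_mono[OF A B] assms by simp
  also have "\<dots> \<le> (a * Q + b * P)\<^sup>2"
    using sum_squares_ge_zero[of "a * Q - b * P" 0] by (simp add: power2_eq_square algebra_simps)
  finally have "2 * (c * (A * B)) \<le> a * Q + b * P"
    by (rule power2_le_imp_le) (use assms in simp)
  with A B show ?thesis
    by (simp add: power2_eq_square algebra_simps)
qed

text \<open>
  For every \<open>c < 1\<close> the inequality with the factor \<open>c\<close> on the left holds near each point, since
  there the angle increments are small and may be compared with chords. As it is preserved by joining
  intervals, bisection extends it to \<open>[a, b]\<close>; then \<open>c\<close> tends to 1.
\<close>

lemma angle_energy_bound:
  fixes \<theta> F :: "real \<Rightarrow> real"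
  assumes ab: "a \<le> b" and cont: "continuous_on {a..b} \<theta>"
    and F: "F integrable_on {a..b}" "\<And>x. F x \<ge> 0"
    and chord: "\<And>s t. a \<le> s \<Longrightarrow> s \<le> t \<Longrightarrow> t \<le> b \<Longrightarrow>
      2 - 2 * cos (\<theta> t - \<theta> s) \<le> (t - s) * integral {s..t} F"
  shows "(\<theta> b - \<theta> a)\<^sup>2 \<le> (b - a) * integral {a..b} F"
proof (rule field_le_mult_one_interval)
  fix c :: real assume c: "0 < c" "c < 1"
  obtain \<delta> where \<delta>: "\<delta> > 0" "\<And>u. \<bar>u\<bar> < \<delta> \<Longrightarrow> c * u\<^sup>2 \<le> 2 - 2 * cos u"
    using cos_quadratic_bound[OF c(2)] by blast
  have int: "F integrable_on {s..t}" if "a \<le> s" "t \<le> b" for s t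
    using F(1) by (rule integrable_on_subinterval) (use that in auto)
  \<comment> \<open>The restriction to subintervals of \<open>[a, b]\<close> is part of the predicate because the local step of
    the bisection principle ranges over all intervals around \<open>x\<close>.\<close>
  let ?P = "\<lambda>s t. a \<le> s \<and> t \<le> b \<longrightarrow> c * (\<theta> t - \<theta> s)\<^sup>2 \<le> (t - s) * integral {s..t} F"
  have "?P a b"
    using ab
  proof (induction rule: Bolzano[where P = ?P])
    case (trans r s t)
    show ?case
    proof
      assume rt: "a \<le> r \<and> t \<le> b"
      then have "c * ((\<theta> s - \<theta> r) + (\<theta> t - \<theta> s))\<^sup>2 \<le>
          ((s - r) + (t - s)) * (integral {r..s} F + integral {s..t} F)"
        using trans c F(2)
        by (intro quadratic_bounds_combine Henstock_Kurzweil_Integration.integral_nonneg int) auto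
      moreover have "integral {r..s} F + integral {s..t} F = integral {r..t} F"
        using trans rt by (intro Henstock_Kurzweil_Integration.integral_combine int) auto
      ultimately show "c * (\<theta> t - \<theta> r)\<^sup>2 \<le> (t - r) * integral {r..t} F"
        by simp
    qed
  next
    case (local x)
    then obtain d where d: "d > 0" "\<And>t. t \<in> {a..b} \<Longrightarrow> dist t x < d \<Longrightarrow> dist (\<theta> t) (\<theta> x) < \<delta> / 2"
      using cont \<delta>(1) unfolding continuous_on_iff by (metis atLeastAtMost_iff half_gt_zero)
    show ?case
    proof (intro exI[of _ d] conjI allI impI)
      fix s t assume st: "s \<le> x \<and> x \<le> t \<and> t - s < d" "a \<le> s \<and> t \<le> b"
      then have "dist (\<theta> s) (\<theta> x) < \<delta> / 2" "dist (\<theta> t) (\<theta> x) < \<delta> / 2"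
        by (intro d(2); simp add: dist_real_def)+
      then have "\<bar>\<theta> t - \<theta> s\<bar> < \<delta>"
        unfolding dist_real_def by linarith
      then have "c * (\<theta> t - \<theta> s)\<^sup>2 \<le> 2 - 2 * cos (\<theta> t - \<theta> s)"
        by (rule \<delta>(2))
      also have "\<dots> \<le> (t - s) * integral {s..t} F"
        using st by (intro chord) auto
      finally show "c * (\<theta> t - \<theta> s)\<^sup>2 \<le> (t - s) * integral {s..t} F" .
    qed (rule d(1))
  qed
  then show "c * (\<theta> b - \<theta> a)\<^sup>2 \<le> (b - a) * integral {a..b} F"
    by simp
qed

text \<open>
  Strict convexity of the square: a function with increments \<open>\<theta>\<close> and \<open>\<omega> - \<theta>\<close> over \<open>[0, x]\<close> and
  \<open>[x, 1]\<close> costs more than the linear function with total increment \<open>\<omega>\<close>, and the excess is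
  \<open>(\<theta> - \<omega> x)\<^sup>2 / (x (1 - x))\<close>.
\<close>

lemma two_piece_bound_strict:
  fixes x \<theta> \<omega> A B :: real
  assumes x: "0 < x" "x < 1" and A: "\<theta>\<^sup>2 \<le> x * A" and B: "(\<omega> - \<theta>)\<^sup>2 \<le> (1 - x) * B"
    and ne: "\<theta> \<noteq> \<omega> * x"
  shows "\<omega>\<^sup>2 < A + B"
proof -
  have "0 < (\<theta> - \<omega> * x)\<^sup>2"
    using ne by simp
  also have "\<dots> = (1 - x) * \<theta>\<^sup>2 + x * (\<omega> - \<theta>)\<^sup>2 - x * (1 - x) * \<omega>\<^sup>2"
    by (simp add: power2_eq_square algebra_simps)
  also have "\<dots> \<le> (1 - x) * (x * A) + x * ((1 - x) * B) - x * (1 - x) * \<omega>\<^sup>2"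
    using x A B by (intro diff_right_mono add_mono mult_left_mono) auto
  also have "\<dots> = (x * (1 - x)) * (A + B - \<omega>\<^sup>2)"
    by (simp add: algebra_simps)
  finally have "0 < A + B - \<omega>\<^sup>2"
    by (rule zero_less_mult_pos) (use x in simp)
  then show ?thesis by simp
qed

section \<open>The candidate minimizers\<close>

lemma vector2_eq: "(vector [a, b] :: real^2) = a *\<^sub>R vector [1, 0] + b *\<^sub>R vector [0, 1]"
  by (simp add: vec_eq_iff forall_2)

lemma norm_vector2_power2: "(norm (vector [a, b] :: real^2))\<^sup>2 = a\<^sup>2 + b\<^sup>2"
  unfolding power2_norm_eq_inner inner_vec_def sum_2 by (simp add: power2_eq_square)

lemma vector2_diff: "(vector [a, b] :: real^2) - vector [c, d] = vector [a - c, b - d]"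
  by (simp add: vec_eq_iff forall_2)

abbreviation frequency :: "int \<Rightarrow> real" where
  "frequency k \<equiv> 2 * of_int k * pi"

definition n_k_deriv :: "int \<Rightarrow> real \<Rightarrow> real^2" where
  "n_k_deriv k x = vector [- frequency k * sin (frequency k * x), frequency k * cos (frequency k * x)]"

lemma n_k_has_vector_derivative: "(n_k k has_vector_derivative n_k_deriv k x) (at x)"
proof -
  have D: "((\<lambda>x. cos (frequency k * x)) has_field_derivative - frequency k * sin (frequency k * x)) (at x)"
    "((\<lambda>x. sin (frequency k * x)) has_field_derivative frequency k * cos (frequency k * x)) (at x)"
    by (auto intro!: derivative_eq_intros)
  show ?thesis
    unfolding n_k_def[abs_def] n_k_deriv_def
    by (subst (1 2) vector2_eq)
      (use D in \<open>auto intro!: has_vector_derivative_add has_vector_derivative_scaleR[THEN has_vector_derivative_eq_rhs]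
        derivative_eq_intros simp: mult.commute\<close>)
qed

lemma continuous_on_n_k: "continuous_on A (n_k k)"
  by (meson continuous_on_vector_derivative has_vector_derivative_at_within n_k_has_vector_derivative)

lemma continuous_on_n_k_deriv: "continuous_on A (n_k_deriv k)"
  unfolding n_k_deriv_def[abs_def] by (subst vector2_eq) (intro continuous_intros)

lemma norm_n_k: "norm (n_k k x) = 1"
proof (rule power2_eq_imp_eq)
  show "(norm (n_k k x))\<^sup>2 = 1\<^sup>2"
    unfolding n_k_def norm_vector2_power2 by simp
qed simp_all

lemma norm_n_k_deriv: "(norm (n_k_deriv k x))\<^sup>2 = (frequency k)\<^sup>2"
proof -
  have "(norm (n_k_deriv k x))\<^sup>2 = (frequency k)\<^sup>2 * ((sin (frequency k * x))\<^sup>2 + (cos (frequency k * x))\<^sup>2)"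
    unfolding n_k_deriv_def norm_vector2_power2
    by (simp only: power_mult_distrib power2_minus distrib_left)
  then show ?thesis by simp
qed

lemma cos_frequency: "cos (frequency k) = 1" and sin_frequency: "sin (frequency k) = 0"
  using cos_int_2pin[of k] sin_int_2pin[of k] by (simp_all add: mult_ac)

lemma n_k_boundary: "n_k k 0 = e1" "n_k k 1 = e1"
  by (simp_all add: n_k_def e1_def cos_frequency sin_frequency)

lemma L2_continuous:
  fixes f :: "real \<Rightarrow> 'a::euclidean_space"
  assumes "continuous_on {a..b} f"
  shows "f \<in> L2 {a<..<b}"
proof -
  have "continuous_on {a<..<b} f"
    using assms by (rule continuous_on_subset) auto
  then have "f \<in> borel_measurable (lebesgue_on {a<..<b})"
    by (rule continuous_imp_measurable_on_sets_lebesgue) auto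
  moreover have "(\<lambda>x. (norm (f x))\<^sup>2) absolutely_integrable_on {a..b}"
    by (intro absolutely_integrable_continuous_real continuous_intros assms)
  ultimately show ?thesis
    unfolding L2_def absolutely_integrable_on_Icc_iff_Ioo
    by (simp add: integrable_restrict_space set_integrable_def)
qed

lemma n_k_has_weak_derivative: "has_weak_derivative {0<..<1} (n_k k) (n_k_deriv k)"
  by (rule C1_has_weak_derivative[OF n_k_has_vector_derivative continuous_on_n_k_deriv])

lemma n_k_admissible: "n_k k \<in> admissible"
proof -
  have "n_k k \<in> W12 {0<..<1}"
    unfolding W12_def using n_k_has_weak_derivative[of k]
    by (auto intro!: L2_continuous continuous_on_n_k continuous_on_n_k_deriv)
  moreover have "has_boundary_values (n_k k) e1 e1"
    unfolding has_boundary_values_def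
    by (rule exI[of _ "n_k k"]) (simp add: continuous_on_n_k n_k_boundary)
  ultimately show ?thesis
    by (simp add: admissible_def W12_sphere_def norm_n_k)
qed

lemma energy_n_k: "energy (n_k k) = (frequency k)\<^sup>2"
proof -
  have "energy (n_k k) = integral {0..1} (\<lambda>x. (norm (n_k_deriv k x))\<^sup>2)"
    by (rule energy_eq_integral[OF n_k_has_weak_derivative _ continuous_on_n_k])
      (auto intro!: L2_continuous continuous_on_n_k_deriv)
  then show ?thesis
    unfolding norm_n_k_deriv by simp
qed

section \<open>Lifting a competitor to its angle\<close>

text \<open>
  The complement of a null set is dense, and a continuous function inherits a closed condition from a
  dense set. This carries the pointwise almost everywhere conditions on a competitor over to its
  continuous representative, including the end points.
\<close>

lemma AE_le_imp_le_on_Icc: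
  fixes f :: "real \<Rightarrow> real"
  assumes f: "continuous_on {a..b} f" and "a < b" and ae: "AE x in lebesgue_on {a<..<b}. f x \<le> c"
    and x: "x \<in> {a..b}"
  shows "f x \<le> c"
proof -
  obtain N where N: "negligible N" "\<And>x. x \<in> {a<..<b} - N \<Longrightarrow> f x \<le> c"
    using ae by (subst (asm) AE_lebesgue_on_iff_negligible) auto
  let ?S = "{a<..<b} - N"
  have "negligible ({a<..<b} - closure ?S)"
    by (rule negligible_subset[OF N(1)]) (use closure_subset[of ?S] in auto)
  moreover have "open ({a<..<b} - closure ?S)"
    by (intro open_Diff) auto
  ultimately have "{a<..<b} \<subseteq> closure ?S"
    using open_not_negligible by blast
  then have "closure {a<..<b} \<subseteq> closure ?S"
    by (rule closure_minimal) simp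
  moreover have "closure ?S \<subseteq> {a..b}"
    by (rule closure_minimal) auto
  ultimately have S: "closure ?S = {a..b}"
    using \<open>a < b\<close> by auto
  show ?thesis
    by (rule continuous_le_on_closure[of ?S f]) (use f x N(2) S in auto)
qed

text \<open>
  In the interior this is the Cauchy-Schwarz inequality. The formula for the increments is available
  only in the open interval; the end points are reached by shrinking \<open>[s, t]\<close> slightly.
\<close>

lemma increment_energy_bound:
  fixes v g :: "real \<Rightarrow> 'a::euclidean_space"
  assumes v: "continuous_on {0..1} v"
    and g: "\<And>x y. 0 < x \<Longrightarrow> x \<le> y \<Longrightarrow> y < 1 \<Longrightarrow> (g has_integral (v y - v x)) {x..y}"
    and g2: "(\<lambda>x. (norm (g x))\<^sup>2) integrable_on {0..1}"
    and st: "0 \<le> s" "s \<le> t" "t \<le> 1"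
  shows "(norm (v t - v s))\<^sup>2 \<le> (t - s) * integral {s..t} (\<lambda>x. (norm (g x))\<^sup>2)"
proof (cases "s = t")
  case False
  let ?F = "\<lambda>x. (norm (g x))\<^sup>2"
  define h where "h n = (t - s) / 2 * inverse (real (Suc n))" for n
  have h: "0 < h n" "h n \<le> (t - s) / 2" for n
  proof -
    show "0 < h n" using False st by (simp add: h_def)
    have "h n \<le> (t - s) / 2 * 1"
      unfolding h_def using st by (intro mult_left_mono) (auto simp: field_simps)
    then show "h n \<le> (t - s) / 2" by simp
  qed
  have h0: "h \<longlonglongrightarrow> 0"
    unfolding h_def[abs_def] by (intro tendsto_mult_right_zero LIMSEQ_inverse_real_of_nat)
  have int: "?F integrable_on {x..y}" if "0 \<le> x" "y \<le> 1" for x y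
    using g2 by (rule integrable_on_subinterval) (use that in auto)
  have "(norm (v (t - h n) - v (s + h n)))\<^sup>2 \<le> (t - s) * integral {s..t} ?F" for n
  proof -
    have n: "0 < s + h n" "s + h n \<le> t - h n" "t - h n < 1"
      using h[of n] st by auto
    have "(norm (v (t - h n) - v (s + h n)))\<^sup>2 \<le>
        (t - h n - (s + h n)) * integral {s + h n..t - h n} ?F"
      using n by (intro Cauchy_Schwarz_has_integral g int) auto
    also have "\<dots> \<le> (t - s) * integral {s..t} ?F"
      using n h[of n] st
      by (intro mult_mono integral_subset_le Henstock_Kurzweil_Integration.integral_nonneg int) auto
    finally show ?thesis .
  qed
  moreover have "(\<lambda>n. (norm (v (t - h n) - v (s + h n)))\<^sup>2) \<longlonglongrightarrow> (norm (v t - v s))\<^sup>2"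
  proof -
    have "(\<lambda>n. t - h n) \<longlonglongrightarrow> t - 0" "(\<lambda>n. s + h n) \<longlonglongrightarrow> s + 0"
      by (intro tendsto_intros h0)+
    moreover have "t - h n \<in> {0..1}" "s + h n \<in> {0..1}" for n
      using h[of n] st by auto
    ultimately show ?thesis
      using st by (intro tendsto_intros continuous_on_tendsto_compose[OF v]) auto
  qed
  ultimately show ?thesis
    by (intro LIMSEQ_le_const2) auto
qed simp

text \<open>
  The unit vector \<open>(p, q)\<close> has the coordinates \<open>p cos \<alpha> + q sin \<alpha>\<close> and \<open>q cos \<alpha> - p sin \<alpha>\<close> in the
  frame rotated by \<open>\<alpha>\<close>. In the half-plane where the first coordinate is nonnegative, the arcsine of the
  second is the oriented angle to the direction \<open>\<alpha>\<close>.
\<close>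

lemma angle_lift:
  fixes p q \<alpha> :: real
  assumes pq: "p\<^sup>2 + q\<^sup>2 = 1" and pos: "p * cos \<alpha> + q * sin \<alpha> \<ge> 0"
  shows "p = cos (\<alpha> + arcsin (q * cos \<alpha> - p * sin \<alpha>))"
    and "q = sin (\<alpha> + arcsin (q * cos \<alpha> - p * sin \<alpha>))"
    and "\<bar>q * cos \<alpha> - p * sin \<alpha>\<bar> \<le> 1"
proof -
  let ?b = "q * cos \<alpha> - p * sin \<alpha>" and ?a = "p * cos \<alpha> + q * sin \<alpha>"
  \<comment> \<open>The squares of the two coordinates add up to 1, so the first one is determined by the second and
    its sign.\<close>
  have cs: "cos \<alpha> * cos \<alpha> = 1 - sin \<alpha> * sin \<alpha>"
    using sin_cos_squared_add[of \<alpha>] by (simp add: power2_eq_square)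
  have ab: "?a\<^sup>2 + ?b\<^sup>2 = 1"
  proof -
    have "?a\<^sup>2 + ?b\<^sup>2 = (p\<^sup>2 + q\<^sup>2) * ((sin \<alpha>)\<^sup>2 + (cos \<alpha>)\<^sup>2)"
      unfolding power2_eq_square by algebra
    then show ?thesis using pq by simp
  qed
  then have "?b\<^sup>2 \<le> 1"
    by (metis le_add_same_cancel2 zero_le_power2)
  then show b: "\<bar>?b\<bar> \<le> 1"
    by (simp add: abs_square_le_1)
  have sn: "sin (arcsin ?b) = ?b"
    using b by (intro sin_arcsin) linarith+
  have "cos (arcsin ?b) = sqrt (1 - ?b\<^sup>2)"
    using b by (intro cos_arcsin) linarith+
  also have "1 - ?b\<^sup>2 = ?a\<^sup>2"
    using ab by simp
  also have "sqrt (?a\<^sup>2) = ?a"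
    using pos by simp
  finally have cn: "cos (arcsin ?b) = ?a" .
  show "p = cos (\<alpha> + arcsin ?b)"
    unfolding cos_add sn cn using cs by algebra
  show "q = sin (\<alpha> + arcsin ?b)"
    unfolding sin_add sn cn using cs by algebra
qed

text \<open>
  The core of the argument for the continuous representative \<open>v\<close> of a competitor. Distance at most 1
  from \<open>n_k\<close> on the circle means an angle of at most \<open>\<pi> / 3\<close>, which keeps \<open>v\<close> in the half-plane
  around \<open>n_k\<close> where the lift by the arcsine is valid and continuous.
\<close>

lemma lift_energy_bound:
  fixes v g :: "real \<Rightarrow> real^2"
  assumes v: "continuous_on {0..1} v" "\<And>x. x \<in> {0..1} \<Longrightarrow> norm (v x) = 1"
    and close: "\<And>x. x \<in> {0..1} \<Longrightarrow> norm (n_k k x - v x) \<le> 1"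
    and bv: "v 0 = e1" "v 1 = e1"
    and ne: "x \<in> {0<..<1}" "v x \<noteq> n_k k x"
    and g: "\<And>x y. 0 < x \<Longrightarrow> x \<le> y \<Longrightarrow> y < 1 \<Longrightarrow> (g has_integral (v y - v x)) {x..y}"
    and g2: "(\<lambda>x. (norm (g x))\<^sup>2) integrable_on {0..1}"
  shows "(frequency k)\<^sup>2 < integral {0..1} (\<lambda>x. (norm (g x))\<^sup>2)"
proof -
  let ?\<omega> = "frequency k" and ?F = "\<lambda>x. (norm (g x))\<^sup>2"
  define b where "b x = v x $ 2 * cos (?\<omega> * x) - v x $ 1 * sin (?\<omega> * x)" for x
  define \<theta> where "\<theta> x = ?\<omega> * x + arcsin (b x)" for x
  have v_eq: "v x = vector [v x $ 1, v x $ 2]" for x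
    by (simp add: vec_eq_iff forall_2)
  have lift: "v x $ 1 = cos (\<theta> x)" "v x $ 2 = sin (\<theta> x)" "\<bar>b x\<bar> \<le> 1" if x: "x \<in> {0..1}" for x
  proof -
    have 1: "(v x $ 1)\<^sup>2 + (v x $ 2)\<^sup>2 = 1"
      using norm_vector2_power2[of "v x $ 1" "v x $ 2"] v(2)[OF x] v_eq[of x] by simp
    \<comment> \<open>On the unit circle \<open>|n_k - v|\<^sup>2 = 2 - 2 n_k \<bullet> v\<close>, so closeness bounds the inner product
      from below.\<close>
    have "n_k k x - v x = vector [cos (?\<omega> * x) - v x $ 1, sin (?\<omega> * x) - v x $ 2]"
      by (subst v_eq) (simp add: n_k_def vector2_diff)
    then have "(cos (?\<omega> * x) - v x $ 1)\<^sup>2 + (sin (?\<omega> * x) - v x $ 2)\<^sup>2 \<le> 1\<^sup>2"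
      using power_mono[OF close[OF x], of 2] by (simp only: norm_vector2_power2) simp
    then have "2 - 2 * (v x $ 1 * cos (?\<omega> * x) + v x $ 2 * sin (?\<omega> * x)) \<le> 1"
      using 1 sin_cos_squared_add[of "?\<omega> * x"] by (simp add: power2_diff algebra_simps)
    then have 2: "0 \<le> v x $ 1 * cos (?\<omega> * x) + v x $ 2 * sin (?\<omega> * x)"
      by simp
    show "v x $ 1 = cos (\<theta> x)" "v x $ 2 = sin (\<theta> x)" "\<bar>b x\<bar> \<le> 1"
      unfolding \<theta>_def b_def using angle_lift[OF 1 2] by auto
  qed
  have v_lift: "v x = vector [cos (\<theta> x), sin (\<theta> x)]" if "x \<in> {0..1}" for x
    by (subst v_eq) (simp add: lift[OF that])
  have "continuous_on {0..1} b"
    unfolding b_def[abs_def] by (intro continuous_intros v(1))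
  then have cont: "continuous_on {0..1} \<theta>"
    unfolding \<theta>_def[abs_def] using lift(3) by (intro continuous_intros) (auto simp: abs_le_iff)
  have bound: "(\<theta> t - \<theta> s)\<^sup>2 \<le> (t - s) * integral {s..t} ?F" if st: "0 \<le> s" "s \<le> t" "t \<le> 1" for s t
  proof (rule angle_energy_bound)
    show "continuous_on {s..t} \<theta>"
      using cont by (rule continuous_on_subset) (use st in auto)
    show "?F integrable_on {s..t}"
      using g2 by (rule integrable_on_subinterval) (use st in auto)
    fix s' t' assume *: "s \<le> s'" "s' \<le> t'" "t' \<le> t"
    have "2 - 2 * cos (\<theta> t' - \<theta> s') = (cos (\<theta> t') - cos (\<theta> s'))\<^sup>2 + (sin (\<theta> t') - sin (\<theta> s'))\<^sup>2"
      using sin_cos_squared_add[of "\<theta> t'"] sin_cos_squared_add[of "\<theta> s'"]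
      by (simp add: power2_diff cos_diff algebra_simps)
    also have "\<dots> = (norm (v t' - v s'))\<^sup>2"
      using * st by (simp add: v_lift vector2_diff norm_vector2_power2)
    also have "\<dots> \<le> (t' - s') * integral {s'..t'} ?F"
      using * st by (intro increment_energy_bound[OF v(1) g g2]) auto
    finally show "2 - 2 * cos (\<theta> t' - \<theta> s') \<le> (t' - s') * integral {s'..t'} ?F" .
  qed (use st in auto)
  have ends: "\<theta> 0 = 0" "\<theta> 1 = ?\<omega>"
    by (simp_all add: \<theta>_def b_def bv e1_def sin_frequency)
  have "\<theta> x \<noteq> ?\<omega> * x"
    using ne v_lift[of x] by (auto simp: n_k_def)
  moreover have "(\<theta> x)\<^sup>2 \<le> x * integral {0..x} ?F" "(?\<omega> - \<theta> x)\<^sup>2 \<le> (1 - x) * integral {x..1} ?F"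
    using bound[of 0 x] bound[of x 1] ne(1) by (simp_all add: ends)
  ultimately have "?\<omega>\<^sup>2 < integral {0..x} ?F + integral {x..1} ?F"
    using ne(1) by (intro two_piece_bound_strict) auto
  also have "\<dots> = integral {0..1} ?F"
    using ne(1) g2 by (intro Henstock_Kurzweil_Integration.integral_combine) auto
  finally show ?thesis .
qed

section \<open>Strict strong local minimality\<close>

theorem proposition24:
  fixes k :: int
  shows "strict_strong_local_minimizer energy admissible (n_k k)"
proof -
  have "energy m > energy (n_k k)"
    if m: "m \<in> admissible"
      and pos: "0 < Linf_norm {0<..<1} (\<lambda>x. n_k k x - m x)"
      and lt: "Linf_norm {0<..<1} (\<lambda>x. n_k k x - m x) < ereal 1" for m
  proof -
    from m obtain g where mL2: "m \<in> L2 {0<..<1}" and g: "g \<in> L2 {0<..<1}"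
        "has_weak_derivative {0<..<1} m g"
      and sphere: "AE x in lebesgue_on {0<..<1}. norm (m x) = 1"
      by (auto simp: admissible_def W12_sphere_def W12_def)
    from m obtain v where v: "continuous_on {0..1} v" "AE x in lebesgue_on {0<..<1}. m x = v x"
      and bv: "v 0 = e1" "v 1 = e1"
      by (auto simp: admissible_def has_boundary_values_def)
    let ?L = "lebesgue_on {0<..<1::real}"
    have "AE x in ?L. norm (v x) \<le> 1" "AE x in ?L. - norm (v x) \<le> - 1"
      using sphere v(2) by (eventually_elim; simp)+
    then have norm_v: "norm (v x) = 1" if "x \<in> {0..1}" for x
      using AE_le_imp_le_on_Icc[of 0 1 "\<lambda>x. norm (v x)" 1 x]
        AE_le_imp_le_on_Icc[of 0 1 "\<lambda>x. - norm (v x)" "-1" x] that v(1)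
      by (force intro: continuous_intros)
    have "AE x in ?L. ereal (norm (n_k k x - m x)) \<le> Linf_norm {0<..<1} (\<lambda>x. n_k k x - m x)"
      unfolding Linf_norm_def by (rule esssup_AE)
    then have "AE x in ?L. norm (n_k k x - v x) \<le> 1"
      using v(2)
    proof eventually_elim
      case (elim x)
      then have "ereal (norm (n_k k x - v x)) < ereal 1"
        using lt by (metis le_less_trans)
      then show ?case by simp
    qed
    then have close: "norm (n_k k x - v x) \<le> 1" if "x \<in> {0..1}" for x
      by (rule AE_le_imp_le_on_Icc[rotated 2])
        (use that in \<open>auto intro!: continuous_intros continuous_on_n_k v(1)\<close>)
    have "\<exists>x\<in>{0<..<1}. v x \<noteq> n_k k x"
    proof (rule ccontr)
      assume "\<not> (\<exists>x\<in>{0<..<1}. v x \<noteq> n_k k x)"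
      then have "AE x in ?L. v x = n_k k x"
        by (intro AE_I2) auto
      then have "AE x in ?L. ereal (norm (n_k k x - m x)) \<le> 0"
        using v(2) by eventually_elim simp
      moreover have "m \<in> borel_measurable ?L" "n_k k \<in> borel_measurable ?L"
        using mL2 L2_continuous[OF continuous_on_n_k[of "{0..1}" k]] by (auto simp: L2_def)
      then have "(\<lambda>x. ereal (norm (n_k k x - m x))) \<in> borel_measurable ?L"
        by measurable
      ultimately have "Linf_norm {0<..<1} (\<lambda>x. n_k k x - m x) \<le> 0"
        unfolding Linf_norm_def by (intro esssup_I)
      with pos show False by simp
    qed
    then obtain x where x: "x \<in> {0<..<1}" "v x \<noteq> n_k k x"
      by blast
    have "energy (n_k k) = (frequency k)\<^sup>2"
      by (rule energy_n_k)
    also have "\<dots> < integral {0..1} (\<lambda>x. (norm (g x))\<^sup>2)"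
      using square_integrable_on_if_L2[OF g(1)] has_weak_derivative_has_integral[OF g(2) v]
      by (intro lift_energy_bound[OF v(1) norm_v close bv x])
        (auto simp: absolutely_integrable_on_def)
    also have "\<dots> = energy m"
      by (rule energy_eq_integral[OF g(2,1) v, symmetric])
    finally show ?thesis .
  qed
  then show ?thesis
    \<comment> \<open>The neighbourhood is the one of radius 1 in which the angle lift is available.\<close>
    unfolding strict_strong_local_minimizer_def
    by (intro conjI n_k_admissible exI[of _ 1]) auto
qed

end
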